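(* Suppose the components of $\hat{\boldsymbol w}=\hat{\boldsymbol p}\circ\hat{\boldsymbol p}$ are pairwise distinct. Let $(S,N,C)$ be an SCG-tuple with respect to $\hat{\boldsymbol w}$. If $$\sum_{i=1}^k \hat w_{[i]}-\sum_{i\in S}\hat w_i-\sum_{i\in C}\hat w_i>\frac{4}{\gamma}\,\mathrm{gap},$$ then the screening cut $$\sum_{i\in S} z_i+\sum_{i\in N}(1-z_i)\le |S|+|N|-1$$ eliminates some non-optimal solutions but keeps all optimal solutions of the sparse ridge regression problem; that is, every optimal solution $(\boldsymbol\beta,\boldsymbol z)$ of its mixed-integer formulation satisfies the cut, and some feasible, non-optimal $(\boldsymbol\beta,\boldsymbol z)$ violates it.
   Context: Let $d,k$ be integers with $1\le k\le d$, write $[\![d]\!]=\{1,\dots,d\}$, let $\mathcal L:\mathbb R^d\to\mathbb R$ be a convex loss and $\gamma>0$. The sparse ridge regression problem is $v^*=\min_{\boldsymbol\beta\in\mathbb R^d}\{\mathcal L(\boldsymbol\beta)+\gamma\|\boldsymbol\beta\|_2^2:\ \|\boldsymbol\beta\|_0\le k\}$, where $\|\boldsymbol\beta\|_0=|\{i:\beta_i\ne 0\}|$. Its mixed-integer formulation minimizes $\mathcal L(\boldsymbol\beta)+\gamma\|\boldsymbol\beta\|_2^2$ over $(\boldsymbol\beta,\boldsymbol z)\in\mathbb R^d\times\{0,1\}^d$ with $\boldsymbol 1^\top\boldsymbol z\le k$ and $\beta_i(1-z_i)=0$ for all $i\in[\![d]\!]$. The conic relaxation has optimal value $$v_{\rm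 conic}=\min_{\boldsymbol t,\boldsymbol\beta,\boldsymbol z\in[0,1]^d}\Big\{\mathcal L(\boldsymbol\beta)+\gamma\boldsymbol 1^\top\boldsymbol t:\ \boldsymbol 1^\top\boldsymbol z\le k,\ t_i\ge \beta_i^2/z_i\ \forall i\Big\}=\max_{\boldsymbol p\in\mathbb R^d}\ \min_{\boldsymbol\beta\in\mathbb R^d,\ \boldsymbol z\in[0,1]^d,\ \boldsymbol 1^\top\boldsymbol z\le k}\ \mathcal L(\boldsymbol\beta)+\gamma\sum_{i=1}^d\Big(p_i\beta_i-\frac{p_i^2z_i}{4}\Big)$$ (with $\beta^2/0=0$ if $\beta=0$ and $+\infty$ otherwise; the second equality is strong duality). Let $\hat{\boldsymbol\beta},\hat{\boldsymbol p}$ be the optimal solution of the max-min problem ($\hat{\boldsymbol p}$ is an optimal solution of the outer maximization), and $\hat{\boldsymbol w}=\hat{\boldsymbol p}\circ\hat{\boldsymbol p}$ (entrywise square). Let $v_{\rm ub}$ be any upper bound of $v^*$ and $\mathrm{gap}=v_{\rm ub}-v_{\rm conic}$. For a vector $\boldsymbol x$, $x_{[j]}$ denotes its $j$-th largest component, and $\boldsymbol x_R$ its restriction to the index set $R$. SCG-tuple: let $S,N\subseteq[\![d]\!]$ be disjoint with $|S|\le k$, let $R=[\![d]\!]\setminus(S\cup N)$ and $c=\min\{k-|S|,|R|\}$. The triple $(S,N,C)$ is an SCG-tuple with respect to $\hat{\boldsymbol w}$ if $C=\{i\in R:\ \hat w_i\ge(\hat{\boldsymbol w}_R)_{[c]}\}$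 (and $C=\emptyset$ if $c=0$). *)

theory Defs
  imports "HOL-Analysis.Analysis" "HOL-Library.Multiset" "HOL-Library.Extended_Real"
begin

(* The dimension d is CARD('n).  For convex L, gam > 0 and k >= 1 the sets whose Inf is taken in
   ridge_value and conic_value are nonempty and bounded below, so that Inf is the genuine
   optimal value. *)

definition l0norm :: "real ^ 'n \<Rightarrow> nat" where
  "l0norm \<beta> = card {i. \<beta> $ i \<noteq> 0}"

definition ridge_value :: "(real ^ 'n \<Rightarrow> real) \<Rightarrow> real \<Rightarrow> nat \<Rightarrow> real" where
  "ridge_value L gam k = Inf {L \<beta> + gam * (norm \<beta>)\<^sup>2 | \<beta>. l0norm \<beta> \<le> k}"

definition mip_feasible :: "nat \<Rightarrow> real ^ 'n \<Rightarrow> real ^ 'n \<Rightarrow> bool" where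
  "mip_feasible k \<beta> z \<longleftrightarrow>
     (\<forall>i. z $ i \<in> {0, 1}) \<and> (\<Sum>i\<in>UNIV. z $ i) \<le> real k \<and> (\<forall>i. \<beta> $ i * (1 - z $ i) = 0)"

definition mip_optimal ::
    "(real ^ 'n \<Rightarrow> real) \<Rightarrow> real \<Rightarrow> nat \<Rightarrow> real ^ 'n \<Rightarrow> real ^ 'n \<Rightarrow> bool" where
  "mip_optimal L gam k \<beta> z \<longleftrightarrow>
     mip_feasible k \<beta> z \<and>
     (\<forall>\<beta>' z'. mip_feasible k \<beta>' z' \<longrightarrow>
        L \<beta> + gam * (norm \<beta>)\<^sup>2 \<le> L \<beta>' + gam * (norm \<beta>')\<^sup>2)"

definition relaxed_supports :: "nat \<Rightarrow> (real ^ 'n) set" where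
  "relaxed_supports k = {z. (\<forall>i. 0 \<le> z $ i \<and> z $ i \<le> 1) \<and> (\<Sum>i\<in>UNIV. z $ i) \<le> real k}"

(* b^2 / z for z >= 0, with the convention 0/0 = 0 and b^2/0 = infinity for b nonzero;
   HOL's own division by zero would give 0 in both cases. *)
definition quad_over_lin :: "real \<Rightarrow> real \<Rightarrow> ereal" where
  "quad_over_lin b z =
     (if z = 0 then (if b = 0 then 0 else \<infinity>) else ereal (b\<^sup>2 / z))"

definition conic_value :: "(real ^ 'n \<Rightarrow> real) \<Rightarrow> real \<Rightarrow> nat \<Rightarrow> real" where
  "conic_value L gam k =
     Inf {L \<beta> + gam * (\<Sum>i\<in>UNIV. t $ i) | t \<beta> z.
            z \<in> relaxed_supports k \<and> (\<forall>i. quad_over_lin (\<beta> $ i) (z $ i) \<le> ereal (t $ i))}"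

(* The inner problem of the max-min form of the conic relaxation.  It may be unbounded below
   for some p, hence the extended reals. *)
definition conic_dual :: "(real ^ 'n \<Rightarrow> real) \<Rightarrow> real \<Rightarrow> nat \<Rightarrow> real ^ 'n \<Rightarrow> ereal" where
  "conic_dual L gam k p =
     (INF (\<beta>, z) \<in> UNIV \<times> relaxed_supports k.
        ereal (L \<beta> + gam * (\<Sum>i\<in>UNIV. p $ i * \<beta> $ i - (p $ i)\<^sup>2 * z $ i / 4)))"

definition conic_dual_optimal ::
    "(real ^ 'n \<Rightarrow> real) \<Rightarrow> real \<Rightarrow> nat \<Rightarrow> real ^ 'n \<Rightarrow> bool" where
  "conic_dual_optimal L gam k p \<longleftrightarrow> (\<forall>q. conic_dual L gam k q \<le> conic_dual L gam k p)"

(* The j-th largest component of x restricted to R, counted with multiplicity;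
   meaningful for 1 <= j <= card R. *)
definition jth_largest :: "real ^ 'n \<Rightarrow> 'n set \<Rightarrow> nat \<Rightarrow> real" where
  "jth_largest x R j =
     rev (sorted_list_of_multiset (image_mset (\<lambda>i. x $ i) (mset_set R))) ! (j - 1)"

definition scg_tuple :: "nat \<Rightarrow> real ^ 'n \<Rightarrow> 'n set \<Rightarrow> 'n set \<Rightarrow> 'n set \<Rightarrow> bool" where
  "scg_tuple k w S N C \<longleftrightarrow>
     S \<inter> N = {} \<and> card S \<le> k \<and>
     (let R = UNIV - (S \<union> N); c = min (k - card S) (card R)
      in C = (if c = 0 then {} else {i \<in> R. w $ i \<ge> jth_largest w R c}))"

definition screening_cut :: "'n set \<Rightarrow> 'n set \<Rightarrow> real ^ 'n \<Rightarrow> bool" where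
  "screening_cut S N z \<longleftrightarrow>
     (\<Sum>i\<in>S. z $ i) + (\<Sum>i\<in>N. 1 - z $ i) \<le> real (card S) + real (card N) - 1"

end

theory Submission imports Defs begin

text \<open>
  Strong duality for the conic relaxation is a sandwich theorem: \<open>L\<close> lies above the concave
  function \<open>v_conic - \<gamma> h\<close>, where \<open>h \<beta>\<close> is the least value of
  \<open>\<Sum>i. \<beta>\<^sub>i\<^sup>2 / z\<^sub>i\<close>; the slope of an affine function
  between them is a dual point of value at least \<open>v_conic\<close>.
  Given this, a feasible \<open>(\<beta>, z)\<close> has objective at least
  \<open>L \<beta> + \<gamma> (p \<bullet> \<beta> - (\<Sum>i. w\<^sub>i z\<^sub>i) / 4)\<close>, and replacing \<open>z\<close> here by the indicator of
  the \<open>k\<close> largest weights gives a number that is at least \<open>v_conic\<close>. If \<open>z\<close> violates the cut, then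
  \<open>\<Sum>i. w\<^sub>i z\<^sub>i\<close> is at most the weight of \<open>S \<union> C\<close>, so the objective exceeds
  \<open>v_conic + gap\<close>. Finally, the indicator of \<open>S\<close> with \<open>\<beta> = 0\<close> is feasible and violates the
  cut, hence is not optimal.
\<close>

section \<open>Separation by an affine function\<close>

text \<open>A hyperplane separating the strict epigraph of \<open>f\<close> from \<open>B\<close>
  cannot be vertical, since the epigraph lies over the whole space; so it is the graph of an affine
  function. Taking a set of pairs instead of a concave function avoids asking whether infima are
  attained.\<close>

lemma convex_on_affine_sandwich:
  fixes f :: "'a::euclidean_space \<Rightarrow> real" and B :: "('a \<times> real) set"
  assumes f: "convex_on UNIV f" and B: "convex B" "B \<noteq> {}"
    and le: "\<And>x s. (x, s) \<in> B \<Longrightarrow> s \<le> f x"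
  obtains q a where "\<And>x. a + q \<bullet> x \<le> f x" and "\<And>x s. (x, s) \<in> B \<Longrightarrow> s \<le> a + q \<bullet> x"
proof -
  define A where "A = {(x, s). f x < s}"
  have "convex A"
  proof (rule convexI)
    fix X Y :: "'a \<times> real" and u v :: real
    assume *: "X \<in> A" "Y \<in> A" "0 \<le> u" "0 \<le> v" "u + v = 1"
    obtain x s y t where XY: "X = (x, s)" "Y = (y, t)" by (cases X, cases Y)
    have "f (u *\<^sub>R x + v *\<^sub>R y) \<le> u * f x + v * f y"
      using f * unfolding convex_on_def by blast
    also have "\<dots> < u * s + v * t"
    \<comment> \<open>Strictness comes from a summand with positive weight: the second if
      \<open>u = 0\<close>, otherwise the first.\<close>
    proof (cases "u = 0")
      case True then show ?thesis using * XY by (auto simp: A_def)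
    next
      case False
      then have "u * f x < u * s" "v * f y \<le> v * t"
        using * XY by (auto simp: A_def intro: mult_left_mono)
      then show ?thesis by linarith
    qed
    finally show "u *\<^sub>R X + v *\<^sub>R Y \<in> A" by (simp add: A_def XY)
  qed
  moreover have "A \<noteq> {}"
  proof -
    have "(0, f 0 + 1) \<in> A" by (simp add: A_def)
    then show ?thesis by blast
  qed
  moreover have "A \<inter> B = {}" using le by (force simp: A_def)
  ultimately obtain c b where c: "c \<noteq> 0" "\<forall>X\<in>A. c \<bullet> X \<le> b" "\<forall>X\<in>B. b \<le> c \<bullet> X"
    using separating_hyperplane_sets[of A B] B by blast
  obtain u m where um: "c = (u, m)" by (cases c)
  have A: "u \<bullet> x + m * s \<le> b" if "f x < s" for x s
    using c(2) that by (auto simp: A_def um)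
  have "m \<le> 0"
  proof (rule ccontr)
    assume "\<not> m \<le> 0"
    then have m: "m > 0" by simp
    \<comment> \<open>The first bound puts \<open>(0, s)\<close> into \<open>A\<close>, the second
      makes \<open>m * s\<close> exceed \<open>b\<close>.\<close>
    define s where "s = max (f 0 + 1) (b / m + 1)"
    have "m * s \<le> b" using A[of 0 s] by (simp add: s_def)
    moreover have "m * (b / m + 1) \<le> m * s" using m by (simp add: s_def)
    ultimately show False using m by (simp add: distrib_left)
  qed
  moreover have "m \<noteq> 0"
  proof
    assume m: "m = 0"
    then have "u \<noteq> 0" using c(1) um by (simp add: zero_prod_def)
    define x where "x = ((\<bar>b\<bar> + 1) / (u \<bullet> u)) *\<^sub>R u"
    have "u \<bullet> x = \<bar>b\<bar> + 1" using \<open>u \<noteq> 0\<close> by (simp add: x_def)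
    moreover have "u \<bullet> x \<le> b" using A[of x "f x + 1"] m by simp
    ultimately show False by linarith
  qed
  ultimately have m: "m < 0" by simp
  show thesis
  proof (rule that[of "b / m" "(- 1 / m) *\<^sub>R u"])
    fix x
    have "b / m - (u \<bullet> x) / m \<le> f x"
    \<comment> \<open>The strict epigraph only gives the bound for \<open>s > f x\<close>; let
      \<open>s\<close> decrease to \<open>f x\<close>.\<close>
    proof (rule dense_ge)
      fix s assume "f x < s"
      from A[OF this] show "b / m - (u \<bullet> x) / m \<le> s" using m by (simp add: field_simps)
    qed
    then show "b / m + ((- 1 / m) *\<^sub>R u) \<bullet> x \<le> f x" by simp
  next
    fix x s assume "(x, s) \<in> B"
    then have "b \<le> u \<bullet> x + m * s" using c(3) by (auto simp: um)
    then show "s \<le> b / m + ((- 1 / m) *\<^sub>R u) \<bullet> x" using m by (simp add: field_simps)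
  qed
qed

section \<open>The conic relaxation and its strong duality\<close>

text \<open>Clearing the denominator absorbs the conventions at 0: for \<open>z = 0\<close> the
  product form forces \<open>b = 0\<close>. There it says nothing about \<open>t\<close>, so
  \<open>0 \<le> t\<close> is listed separately.\<close>

lemma quad_over_lin_le_iff:
  assumes "0 \<le> z"
  shows "quad_over_lin b z \<le> ereal t \<longleftrightarrow> 0 \<le> t \<and> b\<^sup>2 \<le> t * z"
proof (cases "z = 0")
  case True
  then show ?thesis by (auto simp: quad_over_lin_def)
next
  case False
  then have z: "z > 0" using assms by simp
  then have "b\<^sup>2 \<le> t * z \<Longrightarrow> 0 \<le> t"
    by (metis order_trans zero_le_mult_iff zero_le_power2 not_less)
  then show ?thesis using z by (auto simp: quad_over_lin_def pos_divide_le_eq)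
qed

text \<open>After expansion only the cross term is left:
  \<open>2 * b1 * b2 \<le> t1 * z2 + t2 * z1\<close>, by multiplying the two hypotheses and the
  AM-GM inequality.\<close>

lemma rotated_cone_convex:
  fixes b1 b2 t1 t2 z1 z2 u v :: real
  assumes "b1\<^sup>2 \<le> t1 * z1" "b2\<^sup>2 \<le> t2 * z2" and nonneg: "0 \<le> t1" "0 \<le> t2" "0 \<le> z1" "0 \<le> z2"
    and uv: "0 \<le> u" "0 \<le> v"
  shows "(u * b1 + v * b2)\<^sup>2 \<le> (u * t1 + v * t2) * (u * z1 + v * z2)"
proof -
  have "(2 * (b1 * b2))\<^sup>2 = 4 * (b1\<^sup>2 * b2\<^sup>2)" by (simp add: power2_eq_square)
  also have "\<dots> \<le> 4 * ((t1 * z1) * (t2 * z2))"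
    using assms by (intro mult_left_mono mult_mono) auto
  also have "\<dots> \<le> (t1 * z2 + t2 * z1)\<^sup>2"
    using zero_le_power2[of "t1 * z2 - t2 * z1"] by (simp add: power2_eq_square algebra_simps)
  finally have "2 * (b1 * b2) \<le> t1 * z2 + t2 * z1"
    by (rule power2_le_imp_le) (use nonneg in simp)
  then have "(u * v) * (2 * (b1 * b2)) \<le> (u * v) * (t1 * z2 + t2 * z1)"
    using uv by (intro mult_left_mono) auto
  moreover have "u\<^sup>2 * b1\<^sup>2 \<le> u\<^sup>2 * (t1 * z1)" "v\<^sup>2 * b2\<^sup>2 \<le> v\<^sup>2 * (t2 * z2)"
    using assms by (auto intro: mult_left_mono)
  ultimately show ?thesis by (simp add: power2_eq_square algebra_simps)
qed

text \<open>A real \<open>Inf\<close> is a lower bound only of a set bounded below. Boundedness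
  holds because \<open>L\<close> has an affine minorant and \<open>t\<close> dominates the squares
  of \<open>\<beta>\<close>, so completing the square bounds each coordinate.\<close>

lemma conic_value_le:
  fixes L :: "real ^ 'n \<Rightarrow> real"
  assumes L: "convex_on UNIV L" and gam: "gam > 0" and z: "z \<in> relaxed_supports k"
    and t: "\<And>i. quad_over_lin (\<beta> $ i) (z $ i) \<le> ereal (t $ i)"
  shows "conic_value L gam k \<le> L \<beta> + gam * (\<Sum>i\<in>UNIV. t $ i)"
proof -
  obtain q a where q: "\<And>x. a + q \<bullet> x \<le> L x"
    \<comment> \<open>A one-point \<open>B\<close> yields the affine minorant.\<close>
    using convex_on_affine_sandwich[OF L, of "{(0, L 0)}"]
    by (metis convex_singleton empty_not_insert order_refl prod.inject singletonD)
  let ?X = "{L \<beta> + gam * (\<Sum>i\<in>UNIV. t $ i) | t \<beta> z.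
            z \<in> relaxed_supports k \<and> (\<forall>i. quad_over_lin (\<beta> $ i) (z $ i) \<le> ereal (t $ i))}"
  have "a - (\<Sum>i\<in>UNIV. (q $ i)\<^sup>2 / (4 * gam)) \<le> L \<beta> + gam * (\<Sum>i\<in>UNIV. t $ i)"
    if z: "z \<in> relaxed_supports k" and t: "\<forall>i. quad_over_lin (\<beta> $ i) (z $ i) \<le> ereal (t $ i)"
    for t \<beta> z :: "real ^ 'n"
  proof -
    have "- ((q $ i)\<^sup>2 / (4 * gam)) \<le> q $ i * \<beta> $ i + gam * t $ i" for i
    proof -
      have zi: "0 \<le> z $ i" "z $ i \<le> 1" using z by (auto simp: relaxed_supports_def)
      have "0 \<le> t $ i" "(\<beta> $ i)\<^sup>2 \<le> t $ i * z $ i"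
        using t quad_over_lin_le_iff[OF zi(1)] by auto
      moreover have "t $ i * z $ i \<le> t $ i * 1"
        using zi \<open>0 \<le> t $ i\<close> by (intro mult_left_mono)
      ultimately have "gam * (\<beta> $ i)\<^sup>2 \<le> gam * t $ i" using gam by simp
      moreover have "0 \<le> (2 * gam * \<beta> $ i + q $ i)\<^sup>2 / (4 * gam)" using gam by simp
      moreover have "(2 * gam * \<beta> $ i + q $ i)\<^sup>2 / (4 * gam)
          = gam * (\<beta> $ i)\<^sup>2 + q $ i * \<beta> $ i + (q $ i)\<^sup>2 / (4 * gam)"
        using gam by (simp add: field_simps power2_eq_square)
      ultimately show ?thesis by linarith
    qed
    then have "(\<Sum>i\<in>UNIV. - ((q $ i)\<^sup>2 / (4 * gam))) \<le> (\<Sum>i\<in>UNIV. q $ i * \<beta> $ i + gam * t $ i)"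
      by (intro sum_mono)
    then show ?thesis using q[of \<beta>]
      by (simp add: inner_vec_def sum.distrib sum_negf sum_distrib_left)
  qed
  then have "bdd_below ?X" by (intro bdd_belowI) blast
  then show ?thesis unfolding conic_value_def
    using z t by (intro cInf_lower) auto
qed

text \<open>This is the inequality that every maximizer of the dual inherits. The witnesses
  \<open>t\<close> and \<open>z\<close> stay existential in \<open>B\<close>, so no optimal
  \<open>z\<close> has to be computed for a given \<open>\<beta>\<close>.\<close>

lemma conic_strong_duality:
  fixes L :: "real ^ 'n \<Rightarrow> real"
  assumes L: "convex_on UNIV L" and gam: "gam > 0"
  shows "\<exists>q. ereal (conic_value L gam k) \<le> conic_dual L gam k q"
proof -
  define v where "v = conic_value L gam k"
  define B :: "((real ^ 'n) \<times> real) set" where "B = {(\<beta>, s). \<exists>t z. z \<in> relaxed_supports k \<and>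
    (\<forall>i. quad_over_lin (\<beta> $ i) (z $ i) \<le> ereal (t $ i)) \<and> s \<le> v - gam * (\<Sum>i\<in>UNIV. t $ i)}"
  have "convex B"
  proof (rule convexI)
    fix X Y :: "(real ^ 'n) \<times> real" and u m :: real
    assume X: "X \<in> B" and Y: "Y \<in> B" and um: "0 \<le> u" "0 \<le> m" "u + m = 1"
    obtain x s y r where XY: "X = (x, s)" "Y = (y, r)" by (cases X, cases Y)
    obtain t z where 1: "z \<in> relaxed_supports k"
      "\<And>i. quad_over_lin (x $ i) (z $ i) \<le> ereal (t $ i)" "s \<le> v - gam * (\<Sum>i\<in>UNIV. t $ i)"
      using X by (auto simp: B_def XY)
    obtain t' z' where 2: "z' \<in> relaxed_supports k"
      "\<And>i. quad_over_lin (y $ i) (z' $ i) \<le> ereal (t' $ i)" "r \<le> v - gam * (\<Sum>i\<in>UNIV. t' $ i)"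
      using Y by (auto simp: B_def XY)
    define T Z where "T = u *\<^sub>R t + m *\<^sub>R t'" and "Z = u *\<^sub>R z + m *\<^sub>R z'"
    have "Z \<in> relaxed_supports k"
    proof -
      have "u * z $ i + m * z' $ i \<le> 1" for i
        using 1(1) 2(1) um by (intro convex_bound_le) (auto simp: relaxed_supports_def)
      moreover have "u * (\<Sum>i\<in>UNIV. z $ i) + m * (\<Sum>i\<in>UNIV. z' $ i) \<le> real k"
        using 1(1) 2(1) um by (intro convex_bound_le) (auto simp: relaxed_supports_def)
      ultimately show ?thesis using 1(1) 2(1) um
        by (auto simp: relaxed_supports_def Z_def sum.distrib sum_distrib_left)
    qed
    moreover have "quad_over_lin ((u *\<^sub>R x + m *\<^sub>R y) $ i) (Z $ i) \<le> ereal (T $ i)" for i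
    proof -
      have z: "0 \<le> z $ i" "0 \<le> z' $ i" using 1(1) 2(1) by (auto simp: relaxed_supports_def)
      have h: "0 \<le> t $ i" "(x $ i)\<^sup>2 \<le> t $ i * z $ i" "0 \<le> t' $ i" "(y $ i)\<^sup>2 \<le> t' $ i * z' $ i"
        using 1(2)[of i] 2(2)[of i] quad_over_lin_le_iff z by auto
      have "0 \<le> Z $ i" "0 \<le> T $ i" using z h um by (auto simp: Z_def T_def)
      then show ?thesis
        using rotated_cone_convex[OF h(2,4,1,3) z um(1,2)]
        by (simp add: quad_over_lin_le_iff) (simp add: Z_def T_def)
    qed
    moreover have "u * s + m * r \<le> v - gam * (\<Sum>i\<in>UNIV. T $ i)"
    proof -
      have "u * s + m * r \<le> u * (v - gam * (\<Sum>i\<in>UNIV. t $ i)) + m * (v - gam * (\<Sum>i\<in>UNIV. t' $ i))"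
        using 1(3) 2(3) um by (intro add_mono mult_left_mono) auto
      also have "\<dots> = (u + m) * v - gam * (\<Sum>i\<in>UNIV. T $ i)"
        by (simp add: T_def sum.distrib sum_distrib_left[symmetric] algebra_simps)
      finally show ?thesis using um by simp
    qed
    ultimately show "u *\<^sub>R X + m *\<^sub>R Y \<in> B" by (auto simp: B_def XY)
  qed
  moreover have "(0, v) \<in> B"
    by (auto simp: B_def relaxed_supports_def quad_over_lin_def intro!: exI[of _ 0])
  moreover have "s \<le> L x" if "(x, s) \<in> B" for x s
    using that conic_value_le[OF L gam] by (force simp: B_def v_def)
  ultimately obtain a r where r: "\<And>x. a + r \<bullet> x \<le> L x"
    and B: "\<And>x s. (x, s) \<in> B \<Longrightarrow> s \<le> a + r \<bullet> x"
    by (rule_tac convex_on_affine_sandwich[OF L, of B]) auto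
  \<comment> \<open>Scaled so that \<open>- r \<bullet> \<beta>\<close> becomes the linear term
    \<open>gam * (q \<bullet> \<beta>)\<close> of the dual.\<close>
  define q where "q = (- 1 / gam) *\<^sub>R r"
  have rq: "r $ i = - gam * q $ i" for i using gam by (simp add: q_def)
  have "v \<le> L \<beta> + gam * (\<Sum>i\<in>UNIV. q $ i * \<beta> $ i - (q $ i)\<^sup>2 * z $ i / 4)"
    if z: "z \<in> relaxed_supports k" for \<beta> z :: "real ^ 'n"
  proof -
    let ?Q = "\<Sum>i\<in>UNIV. (q $ i)\<^sup>2 * z $ i / 4"
    \<comment> \<open>\<open>\<beta>\<^sub>i = q\<^sub>i z\<^sub>i / 2\<close> minimizes \<open>\<beta>\<^sub>i\<^sup>2 / z\<^sub>i - q\<^sub>i \<beta>\<^sub>i\<close>, also in the degenerate case \<open>z\<^sub>i = 0\<close>.\<close>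
    define b where "b = (\<chi> i. q $ i * z $ i / 2)"
    have "quad_over_lin (b $ i) (z $ i) \<le> ereal ((q $ i)\<^sup>2 * z $ i / 4)" for i
    proof -
      have "0 \<le> z $ i" using z by (simp add: relaxed_supports_def)
      then show ?thesis by (simp add: quad_over_lin_le_iff b_def power2_eq_square)
    qed
    then have "(b, v - gam * ?Q) \<in> B"
      unfolding B_def using z
      by (intro CollectI case_prodI exI[of _ "\<chi> i. (q $ i)\<^sup>2 * z $ i / 4"] exI[of _ z]) simp
    \<comment> \<open>Since \<open>r \<bullet> b\<close> is \<open>- 2 * gam * ?Q\<close>, this
      bounds the intercept \<open>a\<close> from below in terms of \<open>z\<close> alone; the
      minorant of \<open>L\<close> then brings in an arbitrary \<open>\<beta>\<close>.\<close>
    from B[OF this] have "v - gam * ?Q \<le> a + r \<bullet> b" .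
    also have "r \<bullet> b = - gam * (2 * ?Q)"
      by (simp add: inner_vec_def b_def rq sum_distrib_left power2_eq_square algebra_simps sum_negf)
    finally have "v + gam * ?Q \<le> a" by (simp add: algebra_simps)
    moreover have "r \<bullet> \<beta> = - gam * (\<Sum>i\<in>UNIV. q $ i * \<beta> $ i)"
      by (simp add: inner_vec_def rq sum_distrib_left sum_negf mult.assoc)
    ultimately show ?thesis using r[of \<beta>] by (simp add: sum_subtractf right_diff_distrib)
  qed
  then have "ereal v \<le> conic_dual L gam k q"
    unfolding conic_dual_def by (intro INF_greatest) auto
  then show ?thesis unfolding v_def by blast
qed

section \<open>Largest components and sums over them\<close>

text \<open>Sorting the indices by value, rather than the multiset of values, ties each order
  statistic to an index; ties are broken by the enumeration of \<open>R\<close>.\<close>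

lemma jth_largest_enum:
  fixes x :: "real ^ 'n"
  obtains xs where "distinct xs" "set xs = R" "sorted_wrt (\<ge>) (map (\<lambda>i. x $ i) xs)"
    and "\<And>j. 1 \<le> j \<Longrightarrow> j \<le> card R \<Longrightarrow> jth_largest x R j = x $ (xs ! (j - 1))"
proof -
  obtain ys where ys: "set ys = R" "distinct ys"
    using finite_distinct_list[of R] by auto
  define us where "us = sort_key (\<lambda>i. x $ i) ys"
  have m: "mset us = mset_set R" using ys mset_set_set[of ys] by (simp add: us_def)
  have us: "distinct us" "set us = R" "sorted (map (\<lambda>i. x $ i) us)"
    using ys by (auto simp: us_def)
  have "sorted_list_of_multiset (image_mset (\<lambda>i. x $ i) (mset_set R)) = map (\<lambda>i. x $ i) us"
    using us(3) by (simp add: m[symmetric] sorted_sort_id flip: mset_map)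
  then have j: "jth_largest x R j = rev (map (\<lambda>i. x $ i) us) ! (j - 1)" for j
    by (simp add: jth_largest_def)
  have len: "length us = card R" using us distinct_card by force
  show thesis
  proof (rule that[of "rev us"])
    show "sorted_wrt (\<ge>) (map (\<lambda>i. x $ i) (rev us))"
      using us(3)
      by (simp add: sorted_wrt_rev flip: rev_map)
    show "jth_largest x R j = x $ (rev us ! (j - 1))" if "1 \<le> j" "j \<le> card R" for j
      using that len j by (simp add: rev_map)
  qed (use us in auto)
qed

text \<open>\<open>T\<close> consists of the first \<open>c\<close> indices in decreasing order.
  Unlike the set above the threshold, which ties can enlarge, it has exactly \<open>c\<close>
  elements.\<close>

lemma ex_top_set:
  fixes x :: "real ^ 'n"
  assumes c: "c \<le> card R"
  obtains T where "T \<subseteq> R" "card T = c"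
    "(\<Sum>i\<in>T. x $ i) = (\<Sum>j = 1..c. jth_largest x R j)"
    "\<And>i. c \<noteq> 0 \<Longrightarrow> i \<in> T \<Longrightarrow> jth_largest x R c \<le> x $ i"
    "\<And>i i'. i \<in> T \<Longrightarrow> i' \<in> R - T \<Longrightarrow> x $ i' \<le> x $ i"
proof -
  obtain xs where xs: "distinct xs" "set xs = R" "sorted_wrt (\<ge>) (map (\<lambda>i. x $ i) xs)"
    and j: "\<And>j. 1 \<le> j \<Longrightarrow> j \<le> card R \<Longrightarrow> jth_largest x R j = x $ (xs ! (j - 1))"
    using jth_largest_enum[of R x] by blast
  have len: "length xs = card R" using xs distinct_card by force
  have mono: "x $ (xs ! b) \<le> x $ (xs ! a)" if "a \<le> b" "b < card R" for a b
    using xs(3) that len by (cases "a = b") (auto simp: sorted_wrt_iff_nth_less)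
  define T where "T = (\<lambda>j. xs ! j) ` {..<c}"
  have inj: "inj_on (\<lambda>j. xs ! j) {..<c}"
    using xs(1) c len by (auto simp: inj_on_def nth_eq_iff_index_eq)
  show thesis
  proof (rule that[of T])
    show "T \<subseteq> R" using xs(2) c len by (auto simp: T_def)
    show "card T = c" using inj by (simp add: T_def card_image)
    have "(\<Sum>i\<in>T. x $ i) = (\<Sum>j<c. x $ (xs ! j))" using inj by (simp add: T_def sum.reindex)
    also have "\<dots> = (\<Sum>j = 1..c. x $ (xs ! (j - 1)))"
      by (rule sum.reindex_bij_witness[of _ "\<lambda>j. j - 1" Suc]) auto
    also have "\<dots> = (\<Sum>j = 1..c. jth_largest x R j)" using c by (intro sum.cong) (auto simp: j)
    finally show "(\<Sum>i\<in>T. x $ i) = (\<Sum>j = 1..c. jth_largest x R j)" .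
    show "jth_largest x R c \<le> x $ i" if c0: "c \<noteq> 0" and i: "i \<in> T" for i
    proof -
      obtain a where "i = xs ! a" "a < c" using i by (auto simp: T_def)
      then show ?thesis using c0 c j[of c] mono[of a "c - 1"] by auto
    qed
    show "x $ i' \<le> x $ i" if i: "i \<in> T" and i': "i' \<in> R - T" for i i'
    proof -
      obtain a where a: "i = xs ! a" "a < c" using i by (auto simp: T_def)
      obtain b where b: "i' = xs ! b" "b < card R"
        using i' xs(2) len by (metis DiffD1 in_set_conv_nth)
      have "c \<le> b" using i' b by (force simp: T_def)
      then show ?thesis using a b mono by auto
    qed
  qed
qed

text \<open>Exchange argument: \<open>A - T\<close> injects into \<open>T - A\<close>, each index
  being sent to one with at least the same value, and what is left of \<open>T - A\<close>
  contributes nonnegatively.\<close>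

lemma sum_le_sum_top:
  fixes f :: "'a \<Rightarrow> real"
  assumes fin: "finite T" "finite A" and card: "card A \<le> card T"
    and nonneg: "\<And>i. i \<in> T \<Longrightarrow> 0 \<le> f i"
    and top: "\<And>i i'. i \<in> T \<Longrightarrow> i' \<in> A - T \<Longrightarrow> f i' \<le> f i"
  shows "sum f A \<le> sum f T"
proof -
  have "card (A - T) \<le> card (T - A)"
    using card fin card_Int_Diff[of A T] card_Int_Diff[of T A] by (simp add: Int_commute)
  then obtain g where g: "inj_on g (A - T)" "g ` (A - T) \<subseteq> T - A"
    using card_le_inj[of "A - T" "T - A"] fin by auto
  have "sum f (A - T) \<le> sum (\<lambda>i. f (g i)) (A - T)"
    using g by (intro sum_mono top) auto
  also have "\<dots> = sum f (g ` (A - T))" using g by (simp add: sum.reindex)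
  also have "\<dots> \<le> sum f (T - A)" using g nonneg fin by (intro sum_mono2) auto
  finally have "sum f (A - T) \<le> sum f (T - A)" .
  then show ?thesis using fin sum.Int_Diff[of A f T] sum.Int_Diff[of T f A]
    by (simp add: Int_commute)
qed

text \<open>\<open>A - S\<close> avoids \<open>N\<close> and has at most \<open>c\<close> elements,
  so its weight is at most that of the top \<open>c\<close> indices of \<open>R\<close>, all of
  which lie in \<open>C\<close>.\<close>

lemma scg_tuple_sum_le:
  fixes w :: "real ^ 'n"
  assumes scg: "scg_tuple k w S N C" and w: "\<And>i. 0 \<le> w $ i"
    and A: "S \<subseteq> A" "A \<inter> N = {}" "card A \<le> k"
  shows "(\<Sum>i\<in>A. w $ i) \<le> (\<Sum>i\<in>S. w $ i) + (\<Sum>i\<in>C. w $ i)"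
proof -
  define R where "R = UNIV - (S \<union> N)"
  define c where "c = min (k - card S) (card R)"
  have C: "C = (if c = 0 then {} else {i \<in> R. w $ i \<ge> jth_largest w R c})"
    unfolding R_def c_def using scg unfolding scg_tuple_def Let_def by blast
  obtain T where T: "T \<subseteq> R" "card T = c" "\<And>i. c \<noteq> 0 \<Longrightarrow> i \<in> T \<Longrightarrow> jth_largest w R c \<le> w $ i"
    "\<And>i i'. i \<in> T \<Longrightarrow> i' \<in> R - T \<Longrightarrow> w $ i' \<le> w $ i"
    using ex_top_set[of c R w] by (metis c_def min.cobounded2)
  have "A - S \<subseteq> R" using A by (auto simp: R_def)
  then have "card (A - S) \<le> card R" by (intro card_mono) auto
  then have "card (A - S) \<le> c" using A by (simp add: c_def card_Diff_subset)
  then have "(\<Sum>i\<in>A - S. w $ i) \<le> (\<Sum>i\<in>T. w $ i)"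
    using T \<open>A - S \<subseteq> R\<close> w by (intro sum_le_sum_top) auto
  also have "\<dots> \<le> (\<Sum>i\<in>C. w $ i)"
  proof (rule sum_mono2)
    show "T \<subseteq> C" using T by (cases "c = 0") (auto simp: C)
  qed (use w in auto)
  finally show ?thesis using sum.subset_diff[OF A(1), of "\<lambda>i. w $ i"] by simp
qed

section \<open>Mixed-integer solutions and violated cuts\<close>

lemma mip_feasible_indicator:
  assumes "card A \<le> k" and "\<And>i. \<beta> $ i \<noteq> 0 \<Longrightarrow> i \<in> A"
  shows "mip_feasible k \<beta> (\<chi> i. indicator A i)"
  using assms by (auto simp: mip_feasible_def indicator_def)

text \<open>Each sparse vector becomes feasible when paired with the indicator of its
  support.\<close>

lemma mip_optimal_le_ridge_value:
  fixes L :: "real ^ 'n \<Rightarrow> real"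
  assumes "mip_optimal L gam k \<beta> z"
  shows "L \<beta> + gam * (norm \<beta>)\<^sup>2 \<le> ridge_value L gam k"
  unfolding ridge_value_def
proof (rule cInf_greatest)
  show "{L \<beta> + gam * (norm \<beta>)\<^sup>2 |\<beta>. l0norm \<beta> \<le> k} \<noteq> {}"
    by (auto simp: l0norm_def intro!: exI[of _ 0])
next
  fix y assume "y \<in> {L \<beta> + gam * (norm \<beta>)\<^sup>2 |\<beta>. l0norm \<beta> \<le> k}"
  then obtain b where b: "y = L b + gam * (norm b)\<^sup>2" "card {i. b $ i \<noteq> 0} \<le> k"
    by (auto simp: l0norm_def)
  then have "mip_feasible k b (\<chi> i. indicator {i. b $ i \<noteq> 0} i)"
    by (intro mip_feasible_indicator) auto
  then show "L \<beta> + gam * (norm \<beta>)\<^sup>2 \<le> y" using assms b by (auto simp: mip_optimal_def)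
qed

text \<open>All \<open>|S| + |N|\<close> terms of the cut are at most 1, so a single term equal to 0
  already makes the cut hold.\<close>

lemma not_screening_cutD:
  assumes bin: "\<And>i. z $ i \<in> {0, 1}" and cut: "\<not> screening_cut S N z"
  shows "i \<in> S \<Longrightarrow> z $ i = 1" and "i \<in> N \<Longrightarrow> z $ i = 0"
proof -
  have le: "z $ i \<le> 1" "0 \<le> z $ i" for i using bin[of i] by auto
  have S: "(\<Sum>i\<in>S. z $ i) \<le> real (card S)"
    using sum_mono[of S "\<lambda>i. z $ i" "\<lambda>_. 1"] le by simp
  have N: "(\<Sum>i\<in>N. 1 - z $ i) \<le> real (card N)"
    using sum_mono[of N "\<lambda>i. 1 - z $ i" "\<lambda>_. 1"] le by simp
  show "z $ i = 1" if i: "i \<in> S"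
  proof (rule ccontr)
    assume "z $ i \<noteq> 1"
    then have "z $ i = 0" using bin[of i] by auto
    moreover have "(\<Sum>j\<in>S - {i}. z $ j) \<le> real (card (S - {i}))"
      using sum_mono[of "S - {i}" "\<lambda>i. z $ i" "\<lambda>_. 1"] le by simp
    moreover have "card S = Suc (card (S - {i}))" using i by (intro card.remove) auto
    ultimately have "(\<Sum>i\<in>S. z $ i) \<le> real (card S) - 1"
      using sum.remove[OF finite i, of "\<lambda>i. z $ i"] by linarith
    then show False using N cut by (simp add: screening_cut_def)
  qed
  show "z $ i = 0" if i: "i \<in> N"
  proof (rule ccontr)
    assume "z $ i \<noteq> 0"
    then have "z $ i = 1" using bin[of i] by auto
    moreover have "(\<Sum>j\<in>N - {i}. 1 - z $ j) \<le> real (card (N - {i}))"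
      using sum_mono[of "N - {i}" "\<lambda>i. 1 - z $ i" "\<lambda>_. 1"] le by simp
    moreover have "card N = Suc (card (N - {i}))" using i by (intro card.remove) auto
    ultimately have "(\<Sum>i\<in>N. 1 - z $ i) \<le> real (card N) - 1"
      using sum.remove[OF finite i, of "\<lambda>i. 1 - z $ i"] by linarith
    then show False using S cut by (simp add: screening_cut_def)
  qed
qed

section \<open>Validity and strictness of the screening cut\<close>

theorem theorem1:
  fixes L :: "real ^ 'n \<Rightarrow> real" and gam v_ub gap :: real and k :: nat
    and p w :: "real ^ 'n" and S N C :: "'n set"
  assumes "1 \<le> k" and "k \<le> CARD('n)"
    and "convex_on UNIV L" and "gam > 0"
    and "conic_dual_optimal L gam k p"
    and "w = p * p"
    and "ridge_value L gam k \<le> v_ub"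
    and "gap = v_ub - conic_value L gam k"
    and "inj (\<lambda>i. w $ i)"
    and "scg_tuple k w S N C"
    and "(\<Sum>i = 1..k. jth_largest w UNIV i) - (\<Sum>i\<in>S. w $ i) - (\<Sum>i\<in>C. w $ i) > 4 / gam * gap"
  shows "(\<forall>\<beta> z. mip_optimal L gam k \<beta> z \<longrightarrow> screening_cut S N z) \<and>
    (\<exists>\<beta> z. mip_feasible k \<beta> z \<and> \<not> mip_optimal L gam k \<beta> z \<and> \<not> screening_cut S N z)"
proof -
  note gam = \<open>gam > 0\<close> and scg = \<open>scg_tuple k w S N C\<close>
  have w: "w $ i = (p $ i)\<^sup>2" for i using assms(6) by (simp add: power2_eq_square)
  have dual: "conic_value L gam k \<le>
      L \<beta> + gam * (\<Sum>i\<in>UNIV. p $ i * \<beta> $ i - (p $ i)\<^sup>2 * z $ i / 4)"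
    if "z \<in> relaxed_supports k" for \<beta> z
  proof -
    obtain q where "ereal (conic_value L gam k) \<le> conic_dual L gam k q"
      using conic_strong_duality assms by blast
    also have "\<dots> \<le> conic_dual L gam k p" using assms(5) by (simp add: conic_dual_optimal_def)
    also have "\<dots> \<le> ereal (L \<beta> + gam * (\<Sum>i\<in>UNIV. p $ i * \<beta> $ i - (p $ i)\<^sup>2 * z $ i / 4))"
      unfolding conic_dual_def using that by (intro INF_lower2[of "(\<beta>, z)"]) auto
    finally show ?thesis by simp
  qed
  have keep: "screening_cut S N z" if opt: "mip_optimal L gam k \<beta> z" for \<beta> z
  proof (rule ccontr)
    assume cut: "\<not> screening_cut S N z"
    have feas: "\<And>i. z $ i \<in> {0, 1}" "(\<Sum>i\<in>UNIV. z $ i) \<le> real k"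
      "\<And>i. \<beta> $ i * (1 - z $ i) = 0"
      using opt by (auto simp: mip_optimal_def mip_feasible_def)
    define A where "A = {i. z $ i = 1}"
    have zA: "z $ i = indicator A i" for i
      using feas(1)[of i] by (auto simp: A_def indicator_def)
    have "card A \<le> k" using feas(2) by (simp add: zA sum.If_cases indicator_def)
    moreover have "S \<subseteq> A" "A \<inter> N = {}"
      using not_screening_cutD(1)[OF feas(1) cut] not_screening_cutD(2)[OF feas(1) cut]
      by (force simp: A_def)+
    ultimately have wA: "(\<Sum>i\<in>A. w $ i) \<le> (\<Sum>i\<in>S. w $ i) + (\<Sum>i\<in>C. w $ i)"
      using scg by (intro scg_tuple_sum_le) (auto simp: w)
    obtain T where T: "card T = k" "(\<Sum>i\<in>T. w $ i) = (\<Sum>i = 1..k. jth_largest w UNIV i)"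
      using ex_top_set[of k UNIV w] assms(2) by metis
    have ind: "(\<Sum>i\<in>UNIV. w $ i * indicator X i) = (\<Sum>i\<in>X. w $ i)" for X
      using sum.inter_restrict[of UNIV "\<lambda>i. w $ i" X]
      by (simp add: indicator_def if_distrib cong: if_cong)
    let ?P = "\<Sum>i\<in>UNIV. p $ i * \<beta> $ i"
    \<comment> \<open>The dual bound is evaluated at the given \<open>\<beta>\<close>, with its own
      support vector replaced by the heaviest one.\<close>
    have "(\<chi> i. indicator T i) \<in> relaxed_supports k"
      using T by (auto simp: relaxed_supports_def indicator_def)
    from dual[OF this, of \<beta>]
    have lower: "conic_value L gam k \<le> L \<beta> + gam * (?P - (\<Sum>i\<in>T. w $ i) / 4)"
      by (simp add: sum_subtractf ind flip: w sum_divide_distrib)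
    \<comment> \<open>For \<open>z $ i = 1\<close> this is
      \<open>(\<beta> $ i - p $ i / 2)\<^sup>2 \<ge> 0\<close>; for \<open>z $ i = 0\<close>
      feasibility forces \<open>\<beta> $ i = 0\<close>.\<close>
    have "p $ i * \<beta> $ i - w $ i * z $ i / 4 \<le> (\<beta> $ i)\<^sup>2" for i
    proof (cases "z $ i = 1")
      case True
      then show ?thesis using zero_le_power2[of "\<beta> $ i - p $ i / 2"]
        by (simp add: w power2_eq_square algebra_simps)
    next
      case False
      then show ?thesis using feas(1)[of i] feas(3)[of i] by auto
    qed
    then have "(\<Sum>i\<in>UNIV. p $ i * \<beta> $ i - w $ i * z $ i / 4) \<le> (\<Sum>i\<in>UNIV. (\<beta> $ i)\<^sup>2)"
      by (rule sum_mono)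
    also have "\<dots> = (norm \<beta>)\<^sup>2"
      unfolding power2_norm_eq_inner inner_vec_def by (simp add: power2_eq_square)
    finally have "?P - (\<Sum>i\<in>A. w $ i) / 4 \<le> (norm \<beta>)\<^sup>2"
      by (simp add: sum_subtractf zA ind flip: sum_divide_distrib)
    then have upper: "gam * (?P - (\<Sum>i\<in>A. w $ i) / 4) \<le> gam * (norm \<beta>)\<^sup>2"
      using gam by simp
    have "4 / gam * gap < (\<Sum>i\<in>T. w $ i) - (\<Sum>i\<in>A. w $ i)"
      using assms(11) wA T by linarith
    \<comment> \<open>The right-hand side is the difference between the inner objectives at the
      supports \<open>A\<close> and \<open>T\<close>.\<close>
    then have "gap < gam * ((\<Sum>i\<in>T. w $ i) / 4 - (\<Sum>i\<in>A. w $ i) / 4)"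
      using gam by (simp add: field_simps)
    then have "v_ub < L \<beta> + gam * (norm \<beta>)\<^sup>2"
      using lower upper assms(8) by (simp add: right_diff_distrib)
    then show False using mip_optimal_le_ridge_value[OF opt] assms(7) by linarith
  qed
  have S: "S \<inter> N = {}" "card S \<le> k" using scg unfolding scg_tuple_def by blast+
  define z :: "real ^ 'n" where "z = (\<chi> i. indicator S i)"
  have "mip_feasible k 0 z" unfolding z_def by (rule mip_feasible_indicator) (use S in simp_all)
  \<comment> \<open>Every term is 1 here. This includes empty \<open>S\<close> and \<open>N\<close>,
    where the cut reads \<open>0 \<le> -1\<close>.\<close>
  moreover have "\<not> screening_cut S N z"
  proof -
    have "(\<Sum>i\<in>N. 1 - z $ i) = (\<Sum>i\<in>N. 1)"
      using S by (intro sum.cong) (auto simp: z_def indicator_def)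
    moreover have "(\<Sum>i\<in>S. z $ i) = (\<Sum>i\<in>S. 1)"
      by (intro sum.cong) (auto simp: z_def)
    ultimately show ?thesis by (simp add: screening_cut_def)
  qed
  ultimately show ?thesis using keep by blast
qed

end
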